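(* Let $f:\mathbb N\to\mathbb C$ be an arbitrary bounded function, and for $t\in\mathbb R$ let $$R(f;t)=\sum_{n=1}^\infty\frac{f(n)e^{2\pi i n^2t}}{n^2}.$$ Then: (i) The function $t\mapsto R(f;t)$ is Hölder continuous with exponent $1/2$, and the same holds for the real-valued functions $|R(f;t)|$, $\operatorname{Re}R(f;t)$, and $\operatorname{Im}R(f;t)$. (ii) The upper box-counting dimensions of the graphs of the functions $|R(f;t)|$, $\operatorname{Re}R(f;t)$, and $\operatorname{Im}R(f;t)$ over the interval $[0,1]$ are at most $3/2$.
   Context: $\mathbb N=\{1,2,3,\dots\}$. A function $g$ is Hölder continuous with exponent $\eta\in(0,1)$ if there is a constant $K>0$ such that $|g(x)-g(y)|\le K|x-y|^\eta$ for all $x,y$ in its domain (here $\mathbb R$; the functions are $1$-periodic). The graph of a real-valued function $g$ over $[0,1]$ is $\{(t,g(t))\in\mathbb R^2:t\in[0,1]\}$. For a bounded set $E\subset\mathbb R^d$ and $r>0$, let $N(E,r)$ be the minimal number of sets of diameter at most $r$ needed to cover $E$. The upper box-counting dimension of $E$ is $\overline{\dim_B}E=\limsup_{r\to0}\frac{\log N(E,r)}{\log(1/r)}$. *)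

theory Defs
  imports "HOL-Analysis.Analysis"
begin

text \<open>The series over \<open>n \<ge> 1\<close> is written with the index shifted by one, so the value
  \<open>f 0\<close> plays no role.\<close>

definition R_series :: "(nat \<Rightarrow> complex) \<Rightarrow> real \<Rightarrow> complex" where
  "R_series f t =
     (\<Sum>n. f (Suc n) * exp (2 * complex_of_real pi * \<i> * (of_nat (Suc n))\<^sup>2 * complex_of_real t)
            / (of_nat (Suc n))\<^sup>2)"

definition holder_continuous :: "real \<Rightarrow> (real \<Rightarrow> 'b::real_normed_vector) \<Rightarrow> bool" where
  "holder_continuous \<eta> g \<longleftrightarrow>
     0 < \<eta> \<and> \<eta> < 1 \<and> (\<exists>K>0. \<forall>x y. norm (g x - g y) \<le> K * \<bar>x - y\<bar> powr \<eta>)"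

definition graph_over :: "real set \<Rightarrow> (real \<Rightarrow> real) \<Rightarrow> (real \<times> real) set" where
  "graph_over S g = (\<lambda>t. (t, g t)) ` S"

text \<open>Boundedness of the covering sets is explicit because \<^const>\<open>diameter\<close> has an unspecified
  value on unbounded sets.\<close>

definition covering_number :: "'a::euclidean_space set \<Rightarrow> real \<Rightarrow> nat" where
  "covering_number E r =
     (LEAST k. \<exists>C. finite C \<and> card C = k \<and> E \<subseteq> \<Union>C \<and> (\<forall>U\<in>C. bounded U \<and> diameter U \<le> r))"

definition upper_box_dim :: "'a::euclidean_space set \<Rightarrow> ereal" where
  "upper_box_dim E =
     Limsup (at_right 0) (\<lambda>r. ereal (ln (real (covering_number E r)) / ln (1 / r)))"

end

theory Submission
  imports Defs "HOL-Real_Asymp.Real_Asymp"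
begin

text \<open>Since \<open>exp\<close> is 1-Lipschitz on the imaginary axis, the \<open>n\<close>-th term of \<open>R_series f\<close> changes by
  \<open>O(min (1/n\<^sup>2) h)\<close> over a distance \<open>h = s\<^sup>2\<close>. Up to a constant this is at most
  \<open>s (1/(1 + (n-1)s) - 1/(1 + ns))\<close>, which telescopes to \<open>s\<close>. A Hoelder exponent \<open>\<eta>\<close>
  allows the graph to meet only \<open>O(\<delta> powr (\<eta> - 1))\<close> squares of side \<open>\<delta>\<close> over each interval of
  length \<open>\<delta>\<close>, whence the dimension bound \<open>2 - \<eta>\<close>.\<close>

section \<open>Hoelder continuity of the series\<close>

text \<open>With \<open>x = (k + 1) * s\<close> the minimum is
  \<open>s\<^sup>2 * min (1 / x\<^sup>2) 1\<close>. Since \<open>1 + x\<close> is at most twice the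
  larger of 1 and \<open>x\<close>, this is at most four times
  \<open>s\<^sup>2 / (1 + x)\<^sup>2\<close>. Lowering one factor \<open>1 + x\<close> to
  \<open>1 + k * s\<close> leaves a product of two denominators that differ by \<open>s\<close>,
  which splits into partial fractions.\<close>

lemma min_le_telescoping:
  fixes s k :: real
  assumes "s > 0" "k \<ge> 0"
  shows "min (1 / (k + 1)\<^sup>2) (s\<^sup>2) \<le> 4 * s * (1 / (1 + k * s) - 1 / (1 + (k + 1) * s))"
proof -
  define x where "x = (k + 1) * s"
  have pos: "x > 0" "1 + k * s > 0" "k * s \<le> x"
    using assms by (auto simp: x_def add_pos_nonneg algebra_simps)
  have "1 / (k + 1)\<^sup>2 = s\<^sup>2 * (1 / x\<^sup>2)"
    using assms by (simp add: x_def power_mult_distrib)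
  then have "min (1 / (k + 1)\<^sup>2) (s\<^sup>2) = s\<^sup>2 * min (1 / x\<^sup>2) 1"
    by (simp add: min_mult_distrib_left)
  also have "min (1 / x\<^sup>2) 1 \<le> 4 / (1 + x)\<^sup>2"
  proof (cases "x \<le> 1")
    case True
    then have "(1 + x)\<^sup>2 \<le> 2\<^sup>2" using pos by (intro power_mono) auto
    then have "1 \<le> 4 / (1 + x)\<^sup>2" using pos by (simp add: field_simps)
    then show ?thesis by simp
  next
    case False
    then have "(1 + x)\<^sup>2 \<le> (2 * x)\<^sup>2" using pos by (intro power_mono) auto
    then have "1 / x\<^sup>2 \<le> 4 / (1 + x)\<^sup>2" using pos by (simp add: field_simps power_mult_distrib)
    then show ?thesis by simp
  qed
  also have "4 / (1 + x)\<^sup>2 \<le> 4 / ((1 + k * s) * (1 + x))"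
    using pos unfolding power2_eq_square by (intro divide_left_mono mult_right_mono) auto
  also have "s\<^sup>2 * (4 / ((1 + k * s) * (1 + x))) = 4 * s * (1 / (1 + k * s) - 1 / (1 + x))"
    using pos by (simp add: x_def field_simps power2_eq_square)
  finally show ?thesis using assms by (simp add: x_def mult_left_mono)
qed

lemma sums_telescoping_reciprocal:
  fixes s :: real
  assumes "s > 0"
  shows "(\<lambda>n. 1 / (1 + real n * s) - 1 / (1 + (real n + 1) * s)) sums 1"
proof -
  have "(\<lambda>n. 1 / (1 + real n * s)) \<longlonglongrightarrow> 0"
    using assms by real_asymp
  from telescope_sums'[OF this] show ?thesis by (simp add: add.commute)
qed

text \<open>The exponent is purely imaginary, so the exponential has modulus 1. This majorant yields
  convergence of the series.\<close>

lemma R_series_term_norm: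
  assumes "cmod c \<le> M"
  shows "norm (c * exp (2 * complex_of_real pi * \<i> * (of_nat (Suc n))\<^sup>2 * complex_of_real t)
            / (of_nat (Suc n))\<^sup>2) \<le> M * (1 / (real (Suc n))\<^sup>2)"
proof -
  have "norm (exp (2 * complex_of_real pi * \<i> * (of_nat (Suc n))\<^sup>2 * complex_of_real t)) = 1"
    using norm_exp_i_times[of "2 * pi * (real (Suc n))\<^sup>2 * t"]
    by (simp only: of_real_mult of_real_power of_real_of_nat_eq of_real_numeral mult_ac)
  then show ?thesis
    using assms by (simp add: norm_mult norm_divide norm_power divide_right_mono del: of_nat_Suc)
qed

text \<open>Factoring out the unimodular \<open>exp (\<i> * b)\<close> leaves the chord length
  \<open>2 * \<bar>sin ((a - b) / 2)\<bar>\<close>; both bounds follow from those on the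
  sine.\<close>

lemma norm_exp_i_diff_le:
  "norm (exp (\<i> * complex_of_real a) - exp (\<i> * complex_of_real b)) \<le> min 2 \<bar>a - b\<bar>"
proof -
  have "exp (\<i> * complex_of_real a) - exp (\<i> * complex_of_real b)
      = exp (\<i> * complex_of_real b) * (exp (\<i> * complex_of_real (a - b)) - 1)"
    by (simp add: algebra_simps flip: exp_add)
  then have eq: "norm (exp (\<i> * complex_of_real a) - exp (\<i> * complex_of_real b)) = 
     norm (exp (\<i> * complex_of_real (a - b)) - 1)"
    by (simp only: norm_mult norm_exp_i_times)
  have "norm (exp (\<i> * complex_of_real (a - b)) - 1) = 2 * \<bar>sin ((a - b) / 2)\<bar>"
    by (rule dist_exp_i_1)
  moreover have "\<bar>sin ((a - b) / 2)\<bar> \<le> \<bar>(a - b) / 2\<bar>" by (rule abs_sin_x_le_abs_x)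
  moreover have "\<bar>sin ((a - b) / 2)\<bar> \<le> 1" by simp
  ultimately show ?thesis unfolding eq by auto
qed

text \<open>The squared frequency cancels against the denominator, so the Lipschitz constant of a
  term does not depend on \<open>n\<close>; the other bound is the decay of the coefficient.\<close>

lemma R_series_term_diff:
  assumes "cmod c \<le> M"
  shows "norm (c * exp (2 * complex_of_real pi * \<i> * (of_nat (Suc n))\<^sup>2 * complex_of_real x)
               / (of_nat (Suc n))\<^sup>2
             - c * exp (2 * complex_of_real pi * \<i> * (of_nat (Suc n))\<^sup>2 * complex_of_real y)
               / (of_nat (Suc n))\<^sup>2)
         \<le> 2 * pi * M * min (1 / (real n + 1)\<^sup>2) \<bar>x - y\<bar>"
proof -
  define k where "k = (real (Suc n))\<^sup>2"
  have k: "k > 0" "k = (real n + 1)\<^sup>2" by (auto simp: k_def add.commute)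
  have M: "M \<ge> 0" using assms norm_ge_zero order_trans by blast
  have e: "2 * complex_of_real pi * \<i> * (of_nat (Suc n))\<^sup>2 * complex_of_real t
      = \<i> * complex_of_real (2 * pi * k * t)" for t
    by (simp add: k_def del: of_nat_Suc)
  have ck: "(of_nat (Suc n))\<^sup>2 = complex_of_real k" by (simp add: k_def del: of_nat_Suc)
  have "norm (exp (\<i> * complex_of_real (2 * pi * k * x)) - exp (\<i> * complex_of_real (2 * pi * k * y)))
      \<le> min 2 \<bar>2 * pi * k * x - 2 * pi * k * y\<bar>"
    by (rule norm_exp_i_diff_le)
  also have "\<bar>2 * pi * k * x - 2 * pi * k * y\<bar> = 2 * pi * k * \<bar>x - y\<bar>"
    using k by (simp add: abs_mult flip: right_diff_distrib)
  \<comment> \<open>The trivial bound 2 is relaxed to \<open>2 * pi\<close>, so that both bounds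
    share one constant.\<close>
  also have "min 2 (2 * pi * k * \<bar>x - y\<bar>) \<le> 2 * pi * k * min (1 / k) \<bar>x - y\<bar>"
    using k(1) pi_ge_two by (simp add: min_mult_distrib_left min_le_iff_disj)
  finally have *: "norm (exp (\<i> * complex_of_real (2 * pi * k * x))
      - exp (\<i> * complex_of_real (2 * pi * k * y))) / k \<le> 2 * pi * min (1 / k) \<bar>x - y\<bar>"
    using k(1) by (simp add: field_simps)
  have "norm (c * exp (\<i> * complex_of_real (2 * pi * k * x)) / complex_of_real k
      - c * exp (\<i> * complex_of_real (2 * pi * k * y)) / complex_of_real k)
    = cmod c * (norm (exp (\<i> * complex_of_real (2 * pi * k * x))
      - exp (\<i> * complex_of_real (2 * pi * k * y))) / k)"
    using k(1) by (simp add: norm_mult norm_divide flip: right_diff_distrib diff_divide_distrib)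
  also have "\<dots> \<le> M * (2 * pi * min (1 / k) \<bar>x - y\<bar>)"
    using k(1) by (intro mult_mono assms * M) auto
  finally show ?thesis unfolding e ck k(2) by (simp add: mult_ac)
qed

lemma holder_continuous_R_series:
  assumes "bounded (f ` {1..})"
  shows "holder_continuous (1/2) (R_series f)"
proof -
  obtain M where M: "M > 0" "\<And>n. cmod (f (Suc n)) \<le> M"
    using assms unfolding bounded_pos by force
  define g where "g n t = f (Suc n) * exp (2 * complex_of_real pi * \<i> * (of_nat (Suc n))\<^sup>2 * complex_of_real t)
            / (of_nat (Suc n))\<^sup>2" for n t
  have R: "R_series f t = (\<Sum>n. g n t)" for t by (simp add: R_series_def g_def)
  have "summable (\<lambda>n. 1 / (real (Suc n))\<^sup>2)"
    using inverse_power_summable[of 2, where ?'a = real]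
    by (subst summable_Suc_iff) (simp add: inverse_eq_divide)
  then have "summable (\<lambda>n. M * (1 / (real (Suc n))\<^sup>2))" by (rule summable_mult)
  then have summ: "summable (\<lambda>n. g n t)" for t
    by (rule summable_comparison_test') (simp only: g_def, rule R_series_term_norm, rule M)
  have "norm (R_series f x - R_series f y) \<le> 8 * pi * M * \<bar>x - y\<bar> powr (1/2)" for x y
  proof (cases "x = y")
    case False
    \<comment> \<open>The telescoped sum is proportional to \<open>s\<close>, so this choice
      produces the exponent 1/2. Telescoping needs \<open>s > 0\<close>, whence the separate case
      \<open>x = y\<close>.\<close>
    define s where "s = sqrt \<bar>x - y\<bar>"
    have s: "s > 0" "s\<^sup>2 = \<bar>x - y\<bar>" using False by (auto simp: s_def)
    \<comment> \<open>The constant is \<open>2 * pi * M\<close> from the term bound times 4 from the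
      telescoping bound.\<close>
    let ?b = "\<lambda>n. 8 * pi * M * s * (1 / (1 + real n * s) - 1 / (1 + (real n + 1) * s))"
    have "?b sums (8 * pi * M * s * 1)"
      by (intro sums_mult sums_telescoping_reciprocal s)
    moreover have "norm (g n x - g n y) \<le> ?b n" for n
    proof -
      have "norm (g n x - g n y) \<le> 2 * pi * M * min (1 / (real n + 1)\<^sup>2) (s\<^sup>2)"
        unfolding g_def s(2) by (rule R_series_term_diff) (rule M)
      also have "\<dots> \<le> 2 * pi * M * (4 * s * (1 / (1 + real n * s) - 1 / (1 + (real n + 1) * s)))"
        using M(1) s(1) by (intro mult_left_mono min_le_telescoping) auto
      finally show ?thesis by (simp add: mult_ac)
    qed
    moreover have "R_series f x - R_series f y = (\<Sum>n. g n x - g n y)"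
      unfolding R by (rule suminf_diff) (rule summ)+
    ultimately have "norm (R_series f x - R_series f y) \<le> 8 * pi * M * s"
      using norm_suminf_le[of "\<lambda>n. g n x - g n y" ?b] by (simp add: sums_iff)
    then show ?thesis by (simp add: s_def powr_half_sqrt)
  qed simp
  moreover have "8 * pi * M > 0" using M by simp
  ultimately show ?thesis unfolding holder_continuous_def by (intro conjI exI[of _ "8 * pi * M"]) auto
qed

text \<open>Meant for the 1-Lipschitz maps \<open>cmod\<close>, \<open>Re\<close> and
  \<open>Im\<close>.\<close>

lemma holder_continuous_contraction:
  assumes "holder_continuous \<eta> g" "\<And>u v. norm (F u - F v) \<le> norm (u - v)"
  shows "holder_continuous \<eta> (\<lambda>t. F (g t))"
  using assms unfolding holder_continuous_def by (meson order_trans)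

section \<open>Box dimension of Hoelder graphs\<close>

text \<open>The Euclidean norm is bounded by the sum of the coordinates; the loss against the sharp
  factor \<open>sqrt 2\<close> does not affect the dimension.\<close>

lemma diameter_square_le:
  fixes a b \<delta> :: real
  assumes "\<delta> > 0"
  shows "diameter ({a..a + \<delta>} \<times> {b..b + \<delta>}) \<le> 2 * \<delta>"
proof (rule diameter_le)
  fix p q :: "real \<times> real"
  assume "p \<in> {a..a + \<delta>} \<times> {b..b + \<delta>}" "q \<in> {a..a + \<delta>} \<times> {b..b + \<delta>}"
  then have "\<bar>fst p - fst q\<bar> \<le> \<delta>" "\<bar>snd p - snd q\<bar> \<le> \<delta>" by auto
  then show "norm (p - q) \<le> 2 * \<delta>"
    using norm_Pair_le[of "fst (p - q)" "snd (p - q)"] by (simp del: fst_diff snd_diff) simp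
qed (use assms in auto)

text \<open>Over a column of width \<open>\<delta>\<close> the graph stays within
  \<open>K * \<delta> powr \<eta>\<close> of its value at the left end, so a stack of about
  \<open>2 * K * \<delta> powr (\<eta> - 1)\<close> squares covers it; there are about
  \<open>1 / \<delta>\<close> columns.\<close>

lemma covering_number_graph_le:
  fixes g :: "real \<Rightarrow> real"
  assumes g: "\<And>x y. norm (g x - g y) \<le> K * \<bar>x - y\<bar> powr \<eta>"
    and K: "K > 0" and \<eta>: "0 < \<eta>" "\<eta> < 1" and \<delta>: "0 < \<delta>" "\<delta> \<le> 1"
  shows "real (covering_number (graph_over {0..1} g) (2 * \<delta>)) \<le> (4 * K + 4) * \<delta> powr (\<eta> - 2)"
proof -
  \<comment> \<open>Columns are numbered \<open>0..m\<close> and squares in a column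
    \<open>0..q\<close>, so the last index also catches \<open>t = 1\<close> and the top of the
    band. The lower edge of the band in column \<open>i\<close> is \<open>b i\<close>.\<close>
  define m where "m = nat \<lfloor>1 / \<delta>\<rfloor>"
  define q where "q = nat \<lfloor>2 * K * \<delta> powr (\<eta> - 1)\<rfloor>"
  define b where "b i = g (real i * \<delta>) - K * \<delta> powr \<eta>" for i
  define S where "S = (\<lambda>(i, j). {real i * \<delta>..real i * \<delta> + \<delta>} \<times>
    {b i + real j * \<delta>..b i + real j * \<delta> + \<delta>})"
  define C where "C = S ` ({..m} \<times> {..q})"
  have floor: "real (nat \<lfloor>x / \<delta>\<rfloor>) * \<delta> \<le> x \<and> x \<le> real (nat \<lfloor>x / \<delta>\<rfloor>) * \<delta> + \<delta>"
    if "x \<ge> 0" for x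
  proof -
    have "real (nat \<lfloor>x / \<delta>\<rfloor>) \<le> x / \<delta>" "x / \<delta> \<le> real (nat \<lfloor>x / \<delta>\<rfloor>) + 1"
      using that \<delta>(1) by simp_all
    then show ?thesis using \<delta>(1) by (simp add: field_simps)
  qed
  have p1: "\<delta> powr (\<eta> - 1) * \<delta> = \<delta> powr \<eta>" and p2: "\<delta> powr (\<eta> - 2) * \<delta> = \<delta> powr (\<eta> - 1)"
    using \<delta>(1) powr_add[of \<delta> "\<eta> - 1" 1] powr_add[of \<delta> "\<eta> - 2" 1] by simp_all
  have cover: "graph_over {0..1} g \<subseteq> \<Union>C"
  proof
    fix p assume "p \<in> graph_over {0..1} g"
    then obtain t where t: "0 \<le> t" "t \<le> 1" "p = (t, g t)" by (auto simp: graph_over_def)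
    define i where "i = nat \<lfloor>t / \<delta>\<rfloor>"
    have i: "real i * \<delta> \<le> t" "t \<le> real i * \<delta> + \<delta>" using floor[OF t(1)] by (auto simp: i_def)
    have im: "i \<le> m" unfolding i_def m_def
      using t \<delta>(1) by (intro nat_mono floor_mono divide_right_mono) auto
    have "\<bar>g t - g (real i * \<delta>)\<bar> \<le> K * \<bar>t - real i * \<delta>\<bar> powr \<eta>" using g by simp
    also have "\<dots> \<le> K * \<delta> powr \<eta>"
      using i K \<eta> by (intro mult_left_mono powr_mono2) auto
    finally have y: "0 \<le> g t - b i" "g t - b i \<le> 2 * K * \<delta> powr \<eta>" by (auto simp: b_def)
    define j where "j = nat \<lfloor>(g t - b i) / \<delta>\<rfloor>"
    have j: "real j * \<delta> \<le> g t - b i" "g t - b i \<le> real j * \<delta> + \<delta>"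
      using floor[OF y(1)] by (auto simp: j_def)
    have "(g t - b i) / \<delta> \<le> 2 * K * \<delta> powr (\<eta> - 1)"
      using y(2) \<delta>(1) p1 by (simp add: pos_divide_le_eq mult.assoc)
    then have jq: "j \<le> q" unfolding j_def q_def by (intro nat_mono floor_mono)
    have "p \<in> S (i, j)" using i j t by (auto simp: S_def)
    then show "p \<in> \<Union>C" using im jq by (auto simp: C_def)
  qed
  have small: "bounded U \<and> diameter U \<le> 2 * \<delta>" if "U \<in> C" for U
    using that \<delta>(1) by (auto simp: C_def S_def bounded_Times diameter_square_le)
  have fin: "finite C" by (simp add: C_def)
  have "covering_number (graph_over {0..1} g) (2 * \<delta>) \<le> card C"
    unfolding covering_number_def
    by (rule Least_le, rule exI[of _ C]) (use cover small fin in simp)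
  also have "card C \<le> card ({..m} \<times> {..q})" unfolding C_def by (rule card_image_le) simp
  also have "\<dots> = (m + 1) * (q + 1)" by simp
  finally have "real (covering_number (graph_over {0..1} g) (2 * \<delta>)) \<le> real ((m + 1) * (q + 1))"
    by (rule of_nat_mono)
  also have "\<dots> = (real m + 1) * (real q + 1)" by (simp only: of_nat_mult of_nat_add of_nat_1)
  \<comment> \<open>Since \<open>\<delta> \<le> 1\<close>, both \<open>1 / \<delta>\<close> and
    \<open>\<delta> powr (\<eta> - 1)\<close> are at least 1 and absorb the added ones.\<close>
  also have "\<dots> \<le> (2 / \<delta>) * ((2 * K + 2) * \<delta> powr (\<eta> - 1))"
  proof (rule mult_mono)
    have "real m \<le> 1 / \<delta>" unfolding m_def using \<delta> by simp
    moreover have "1 \<le> 1 / \<delta>" using \<delta> by simp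
    ultimately show "real m + 1 \<le> 2 / \<delta>" by simp
    have "real q \<le> 2 * K * \<delta> powr (\<eta> - 1)" unfolding q_def using K by simp
    moreover have "\<delta> powr 0 \<le> \<delta> powr (\<eta> - 1)" using \<delta> \<eta> by (intro powr_mono') auto
    ultimately show "real q + 1 \<le> (2 * K + 2) * \<delta> powr (\<eta> - 1)"
      using \<delta>(1) by (simp add: algebra_simps)
  qed (use \<delta> in auto)
  also have "\<dots> = (4 * K + 4) * \<delta> powr (\<eta> - 2)"
    using \<delta>(1) by (simp add: field_simps flip: p2)
  finally show ?thesis .
qed

text \<open>Take logarithms in the covering bound with \<open>\<delta> = r / 2\<close>. After
  division by \<open>ln (1 / r)\<close> the terms from \<open>4 * K + 4\<close> and from the factor
  2 vanish in the limit.\<close>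

lemma upper_box_dim_graph_holder:
  fixes g :: "real \<Rightarrow> real"
  assumes "holder_continuous \<eta> g"
  shows "upper_box_dim (graph_over {0..1} g) \<le> ereal (2 - \<eta>)"
proof -
  obtain K where K: "K > 0" "\<And>x y. norm (g x - g y) \<le> K * \<bar>x - y\<bar> powr \<eta>" and \<eta>: "0 < \<eta>" "\<eta> < 1"
    using assms by (auto simp: holder_continuous_def)
  let ?N = "covering_number (graph_over {0..1} g)"
  let ?B = "\<lambda>r. (ln (4 * K + 4) + (2 - \<eta>) * ln (2 / r)) / ln (1 / r)"
  have "ln (real (?N r)) / ln (1 / r) \<le> ?B r" if r: "0 < r" "r < 1" for r
  proof -
    have nonneg: "0 \<le> ln (4 * K + 4) + (2 - \<eta>) * ln (2 / r)"
      using K(1) \<eta> r by simp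
    have "ln (real (?N r)) \<le> ln (4 * K + 4) + (2 - \<eta>) * ln (2 / r)"
    \<comment> \<open>As \<open>ln 0 = 0\<close> in HOL, the zero case reduces to nonnegativity of
      the right-hand side.\<close>
    proof (cases "?N r = 0")
      case False
      have "real (?N r) \<le> (4 * K + 4) * (r / 2) powr (\<eta> - 2)"
        using covering_number_graph_le[OF K(2,1) \<eta>, of "r / 2"] r by simp
      then have "ln (real (?N r)) \<le> ln ((4 * K + 4) * (r / 2) powr (\<eta> - 2))"
        using False by (subst ln_le_cancel_iff) (use K(1) r in auto)
      also have "\<dots> = ln (4 * K + 4) + (2 - \<eta>) * ln (2 / r)"
        using K(1) r by (simp add: ln_mult_pos ln_powr ln_div left_diff_distrib right_diff_distrib)
      finally show ?thesis .
    qed (use nonneg in simp)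
    then show ?thesis using r by (intro divide_right_mono) auto
  qed
  then have "\<forall>\<^sub>F r in at_right 0. ereal (ln (real (?N r)) / ln (1 / r)) \<le> ereal (?B r)"
    by (intro eventually_at_rightI[of 0 1]) auto
  then have "upper_box_dim (graph_over {0..1} g) \<le> Limsup (at_right 0) (\<lambda>r. ereal (?B r))"
    unfolding upper_box_dim_def by (rule Limsup_mono)
  also have "\<dots> = ereal (2 - \<eta>)"
  proof (rule lim_imp_Limsup)
    have "(?B \<longlongrightarrow> 2 - \<eta>) (at_right 0)" using \<eta> K(1) by real_asymp
    then show "((\<lambda>r. ereal (?B r)) \<longlongrightarrow> ereal (2 - \<eta>)) (at_right 0)" by simp
  qed simp
  finally show ?thesis .
qed

theorem corollary5p2:
  fixes f :: "nat \<Rightarrow> complex"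
  assumes "bounded (f ` {1..})"
  shows "(holder_continuous (1/2) (R_series f)
          \<and> holder_continuous (1/2) (\<lambda>t. cmod (R_series f t))
          \<and> holder_continuous (1/2) (\<lambda>t. Re (R_series f t))
          \<and> holder_continuous (1/2) (\<lambda>t. Im (R_series f t)))
       \<and> (upper_box_dim (graph_over {0..1} (\<lambda>t. cmod (R_series f t))) \<le> ereal (3/2)
          \<and> upper_box_dim (graph_over {0..1} (\<lambda>t. Re (R_series f t))) \<le> ereal (3/2)
          \<and> upper_box_dim (graph_over {0..1} (\<lambda>t. Im (R_series f t))) \<le> ereal (3/2))"
proof -
  have R: "holder_continuous (1/2) (R_series f)"
    using assms by (rule holder_continuous_R_series)
  have "holder_continuous (1/2) (\<lambda>t. cmod (R_series f t))"
    by (rule holder_continuous_contraction[OF R]) (simp add: norm_triangle_ineq3)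
  moreover have "holder_continuous (1/2) (\<lambda>t. Re (R_series f t))"
    by (rule holder_continuous_contraction[OF R]) (metis abs_Re_le_cmod minus_complex.simps(1) real_norm_def)
  moreover have "holder_continuous (1/2) (\<lambda>t. Im (R_series f t))"
    by (rule holder_continuous_contraction[OF R]) (metis abs_Im_le_cmod minus_complex.simps(2) real_norm_def)
  \<comment> \<open>For \<open>\<eta> = 1/2\<close> the bound \<open>2 - \<eta>\<close> is
    3/2.\<close>
  ultimately show ?thesis
    using R upper_box_dim_graph_holder[of "1/2"] by simp
qed

end
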